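(* Let $\mathbb H,\mathbb V,\mathbb M_1,\mathbb M_2$, $\mathsf A_\star$, $\mathsf B$, $\mathsf A$, $\mathsf G$ satisfy all the hypotheses of the abstract framework described in the context, and let $\mathbb M:=\mathbb M_1\times\mathbb M_2$. Let $F\in W^1(\mathbb H)$ and $\Xi=(\xi,\chi)\in W^2(\mathbb M)$, and let $U\in\mathcal C^1([0,\infty);\mathbb H)\cap\mathcal C([0,\infty);\mathbb V)$ be the (unique) solution of $$\dot U(t)=\mathsf A_\star U(t)+\mathsf G\xi(t)+F(t)\quad t\ge0,\qquad\mathsf BU(t)=\chi(t)\quad t\ge0,\qquad U(0)=0.$$ Let $\underline U:=EU$, $\underline\xi:=E\xi$, $\underline\chi:=E\chi$, $\underline F:=EF$, where $E$ denotes extension by zero to negative times. Then $\underline U$ is the unique solution of $$\underline U\in\mathrm{TD}(\mathbb V),\qquad\dot{\underline U}=\mathsf A_\star\underline U+\mathsf G\underline\xi+\underline F,\qquad\mathsf B\underline U=\underline\chi .$$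
   Context: Abstract framework. $\mathbb H,\mathbb V,\mathbb M_1,\mathbb M_2$ are (real) Hilbert spaces, with $\mathbb V$ continuously embedded into $\mathbb H$. $\mathsf A_\star:\mathbb V\to\mathbb H$ and $\mathsf G:\mathbb M_1\to\mathbb H$ are bounded linear operators, and $\mathsf B:\mathbb V\to\mathbb M_2$ is a bounded linear surjective operator. The following hypotheses hold: (i) There are constants $C_1^\star,C_2^\star>0$ with $C_1^\star\|U\|_{\mathbb V}\le\|U\|_{\mathbb H}+\|\mathsf A_\star U\|_{\mathbb H}\le C_2^\star\|U\|_{\mathbb V}$ for all $U\in\mathbb V$. (ii) Let $\mathsf A:=\mathsf A_\star|_{D(\mathsf A)}:D(\mathsf A)\subset\mathbb H\to\mathbb H$ with $D(\mathsf A):=\mathrm{Ker}\,\mathsf B$. Then $(\mathsf AU,U)_{\mathbb H}=0$ for all $U\in D(\mathsf A)$, and both $\mathsf I+\mathsf A$ and $\mathsf I-\mathsf A$ map $D(\mathsf A)$ onto $\mathbb H$ (that is, $\pm\mathsf A$ are maximal dissipative). (iii) For every $\Xi=(\xi,\chi)\in\mathbb M:=\mathbb M_1\times\mathbb M_2$ there exists a unique $U\in\mathbb V$ with $U=\mathsf A_\star U+\mathsf G\xi$ and $\mathsf BU=\chi$, and $\|U\|_{\mathbb H}+\|U\|_{\mathbb V}\le C_{\mathrm{lift}}\|\Xi\|_{\mathbb M}$, with $C_{\mathrm{lift}}$ independent of $\Xi$. For a Hilbert space $X$ and $k\ge1$, $W^k(X):=\{f\in\mathcal C^{k-1}([0,\infty);X):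 f^{(k)}\in L^1((0,\infty);X),\ f^{(\ell)}(0)=0,\ 0\le\ell\le k-1\}$. Under these hypotheses the evolution problem in the claim has a unique solution in $\mathcal C^1([0,\infty);\mathbb H)\cap\mathcal C([0,\infty);\mathbb V)$. For $f$ defined on $[0,\infty)$, $Ef(t):=f(t)$ for $t\ge0$ and $Ef(t):=0$ for $t<0$. For a Banach space $X$, an $X$-valued distribution is a sequentially continuous linear map $\mathcal D(\mathbb R)\to X$, and $\mathrm{TD}(X)$ is the set of $X$-valued distributions $f$ such that $f=g^{(k)}$ (distributional derivative) for some integer $k\ge0$ and some continuous $g:\mathbb R\to X$ with $g(t)=0$ for $t\le0$ and $\|g(t)\|\le Ct^m$ for $t\ge1$, for some $C$ and $m\ge0$. In the distributional problem the dot is the distributional derivative, the first equation is an equality of $\mathbb H$-valued distributions, the second one of $\mathbb M_2$-valued distributions, and time-independent operators act on distributions by composition. *)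

theory Defs
  imports "HOL-Analysis.Analysis"
begin

section \<open>The abstract framework\<close>

text \<open>
  The continuous embedding of \<open>V\<close> into \<open>H\<close> is the injective bounded linear map \<open>J\<close>. An element
  \<open>U\<close> of the domain of \<open>A = A_star |_ Ker B\<close> is thus a \<open>U :: 'v\<close> with \<open>B U = 0\<close>, identified with
  \<open>J U :: 'h\<close>. All spaces are real, complete, and not assumed separable.
\<close>

locale evolution_framework =
  fixes J :: "'v::{real_inner,banach} \<Rightarrow> 'h::{real_inner,banach}"
    and A_star :: "'v \<Rightarrow> 'h"
    and G :: "'m1::{real_inner,banach} \<Rightarrow> 'h"
    and B :: "'v \<Rightarrow> 'm2::{real_inner,banach}"
  assumes embedding: "bounded_linear J" "inj J"
    and bounded_linear_A_star: "bounded_linear A_star"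
    and bounded_linear_G: "bounded_linear G"
    and bounded_linear_B: "bounded_linear B"
    and surj_B: "surj B"
    and graph_norm: "\<exists>C1>0. \<exists>C2>0. \<forall>U.
          C1 * norm U \<le> norm (J U) + norm (A_star U) \<and>
          norm (J U) + norm (A_star U) \<le> C2 * norm U"
    and skew: "\<And>U. B U = 0 \<Longrightarrow> A_star U \<bullet> J U = 0"
    and range_plus: "(\<lambda>U. J U + A_star U) ` {U. B U = 0} = UNIV"
    and range_minus: "(\<lambda>U. J U - A_star U) ` {U. B U = 0} = UNIV"
    and lifting_ex1: "\<And>\<xi> chi. \<exists>!U. J U = A_star U + G \<xi> \<and> B U = chi"
    and lifting_bound: "\<exists>C. \<forall>\<xi> chi U. J U = A_star U + G \<xi> \<and> B U = chi \<longrightarrow>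
          norm (J U) + norm U \<le> C * norm (\<xi>, chi)"


section \<open>Function spaces on the half line\<close>

text \<open>Only the values on \<open>[0,\<infinity>)\<close> matter; at \<open>t = 0\<close> the derivative is one-sided.\<close>

definition half_deriv :: "(real \<Rightarrow> 'a::real_normed_vector) \<Rightarrow> real \<Rightarrow> 'a" where
  "half_deriv f t = vector_derivative f (at t within {0..})"

definition C_half :: "nat \<Rightarrow> (real \<Rightarrow> 'a::real_normed_vector) \<Rightarrow> bool" where
  "C_half k f \<longleftrightarrow>
     (\<forall>l<k. \<forall>t\<ge>0. (half_deriv ^^ l) f differentiable (at t within {0..})) \<and>
     (\<forall>l\<le>k. continuous_on {0..} ((half_deriv ^^ l) f))"

text \<open>
  The library's \<^const>\<open>integrable\<close> requires a second countable target. For a general Banach space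
  we use the usual description of \<open>L\<^sup>1\<close>: strongly measurable with integrable norm.
\<close>

definition L1_on :: "real set \<Rightarrow> (real \<Rightarrow> 'a::banach) \<Rightarrow> bool" where
  "L1_on S g \<longleftrightarrow>
     (\<exists>s. (\<forall>n. simple_function (lebesgue_on S) (s n)) \<and>
          (AE t in lebesgue_on S. (\<lambda>n. s n t) \<longlonglongrightarrow> g t)) \<and>
     integrable (lebesgue_on S) (\<lambda>t. norm (g t))"

text \<open>
  The space \<open>W\<^sup>k(X)\<close>, \<open>k \<ge> 1\<close>. As usual, \<open>f\<^sup>(\<^sup>k\<^sup>) \<in> L\<^sup>1\<close> means that \<open>f\<^sup>(\<^sup>k\<^sup>-\<^sup>1\<^sup>)\<close> is a primitive of an \<open>L\<^sup>1\<close>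
  function \<open>g\<close>. On Bochner integrable functions the gauge integral \<^const>\<open>has_integral\<close> agrees with
  the Bochner integral.
\<close>

definition W_half :: "nat \<Rightarrow> (real \<Rightarrow> 'a::banach) \<Rightarrow> bool" where
  "W_half k f \<longleftrightarrow> 1 \<le> k \<and> C_half (k - 1) f \<and>
     (\<exists>g. L1_on {0<..} g \<and>
        (\<forall>t\<ge>0. (g has_integral ((half_deriv ^^ (k - 1)) f t - (half_deriv ^^ (k - 1)) f 0)) {0..t})) \<and>
     (\<forall>l\<le>k - 1. (half_deriv ^^ l) f 0 = 0)"

definition ext0 :: "(real \<Rightarrow> 'a::zero) \<Rightarrow> real \<Rightarrow> 'a" where
  "ext0 f t = (if t \<ge> 0 then f t else 0)"


section \<open>Test functions\<close>

definition smooth_fun :: "(real \<Rightarrow> real) \<Rightarrow> bool" where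
  "smooth_fun \<phi> \<longleftrightarrow> (\<forall>n x. (deriv ^^ n) \<phi> field_differentiable (at x))"

definition supp :: "(real \<Rightarrow> real) \<Rightarrow> real set" where
  "supp \<phi> = closure {x. \<phi> x \<noteq> 0}"

lemma funpow_deriv_add:
  assumes "smooth_fun f" "smooth_fun g"
  shows "(deriv ^^ n) (\<lambda>x. f x + g x) = (\<lambda>x. (deriv ^^ n) f x + (deriv ^^ n) g x)"
proof (induction n)
  case (Suc n)
  show ?case
    using assms by (intro ext) (simp add: Suc.IH smooth_fun_def)
qed simp

lemma funpow_deriv_cmult:
  assumes "smooth_fun f"
  shows "(deriv ^^ n) (\<lambda>x. c * f x) = (\<lambda>x. c * (deriv ^^ n) f x)"
proof (induction n)
  case (Suc n)
  show ?case
    using assms by (intro ext) (simp add: Suc.IH smooth_fun_def)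
qed simp

lemma funpow_deriv_zero: "(deriv ^^ n) (\<lambda>x::real. 0::real) = (\<lambda>x. 0)"
  by (induction n) simp_all

lemma smooth_fun_add: "smooth_fun f \<Longrightarrow> smooth_fun g \<Longrightarrow> smooth_fun (\<lambda>x. f x + g x)"
  using funpow_deriv_add[of f g]
  by (auto simp: smooth_fun_def intro!: field_differentiable_add)

lemma smooth_fun_cmult: "smooth_fun f \<Longrightarrow> smooth_fun (\<lambda>x. c * f x)"
  using funpow_deriv_cmult[of f]
  by (auto simp: smooth_fun_def intro!: field_differentiable_mult field_differentiable_const)

lemma smooth_fun_zero: "smooth_fun (\<lambda>x. 0)"
  by (simp add: smooth_fun_def funpow_deriv_zero field_differentiable_const)

lemma smooth_fun_deriv:
  assumes "smooth_fun f"
  shows "smooth_fun (deriv f)"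
  unfolding smooth_fun_def
proof (intro allI)
  fix n x
  have "(deriv ^^ Suc n) f field_differentiable at x"
    using assms unfolding smooth_fun_def by blast
  then show "(deriv ^^ n) (deriv f) field_differentiable at x"
    by (simp only: funpow_Suc_right o_def)
qed

lemma compact_supp_mono:
  assumes "compact (supp f)" "{x. g x \<noteq> 0} \<subseteq> supp f"
  shows "compact (supp g)"
proof -
  have "supp g \<subseteq> supp f"
    using assms(2) unfolding supp_def by (simp add: closure_minimal)
  then show ?thesis
    using assms(1) by (metis supp_def closed_closure compact_Int_closed inf.absorb_iff2)
qed

lemma compact_supp_add:
  assumes "compact (supp f)" "compact (supp g)"
  shows "compact (supp (\<lambda>x. f x + g x))"
proof -
  have sub: "supp (\<lambda>x. f x + g x) \<subseteq> supp f \<union> supp g"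
    unfolding supp_def closure_Un[symmetric] by (rule closure_mono) auto
  have "closed (supp (\<lambda>x. f x + g x))"
    by (simp add: supp_def)
  then have "compact ((supp f \<union> supp g) \<inter> supp (\<lambda>x. f x + g x))"
    using assms by (intro compact_Int_closed compact_Un)
  with sub show ?thesis by (simp add: Int_absorb1)
qed

lemma deriv_eq_0_outside_supp:
  assumes "x \<notin> supp f"
  shows "deriv f x = 0"
proof -
  have "open (- supp f)" "x \<in> - supp f"
    using assms by (auto simp: supp_def)
  moreover have "\<And>y. y \<in> - supp f \<Longrightarrow> f y = 0"
    using closure_subset[of "{x. f x \<noteq> 0}"] by (auto simp: supp_def)
  ultimately have "eventually (\<lambda>y. f y = 0) (nhds x)"
    unfolding eventually_nhds by blast
  then have "deriv f x = deriv (\<lambda>y. 0) x"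
    by (rule deriv_cong_ev) simp
  then show ?thesis by simp
qed

typedef test_fun = "{\<phi>. smooth_fun \<phi> \<and> compact (supp \<phi>)}"
  morphisms fun_of Test
  by (rule exI[of _ "\<lambda>x. 0"]) (simp add: smooth_fun_zero supp_def)

setup_lifting type_definition_test_fun

instantiation test_fun :: real_vector
begin

lift_definition zero_test_fun :: test_fun is "\<lambda>x. 0"
  by (simp add: smooth_fun_zero supp_def)

lift_definition plus_test_fun :: "test_fun \<Rightarrow> test_fun \<Rightarrow> test_fun" is "\<lambda>f g x. f x + g x"
  by (simp add: smooth_fun_add compact_supp_add)

lift_definition scaleR_test_fun :: "real \<Rightarrow> test_fun \<Rightarrow> test_fun" is "\<lambda>c f x. c * f x"
proof -
  fix c :: real and f :: "real \<Rightarrow> real"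
  assume f: "smooth_fun f \<and> compact (supp f)"
  have "{x. c * f x \<noteq> 0} \<subseteq> supp f"
    using closure_subset[of "{x. f x \<noteq> 0}"] by (auto simp: supp_def)
  with f show "smooth_fun (\<lambda>x. c * f x) \<and> compact (supp (\<lambda>x. c * f x))"
    using smooth_fun_cmult compact_supp_mono[of f] by simp
qed

definition uminus_test_fun :: "test_fun \<Rightarrow> test_fun" where
  "uminus_test_fun \<phi> = (-1) *\<^sub>R \<phi>"

definition minus_test_fun :: "test_fun \<Rightarrow> test_fun \<Rightarrow> test_fun" where
  "minus_test_fun \<phi> \<psi> = \<phi> + (-1) *\<^sub>R \<psi>"

instance
  by (standard; (unfold uminus_test_fun_def minus_test_fun_def)?; transfer)
     (auto simp: algebra_simps fun_eq_iff)

end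

lift_definition test_deriv :: "test_fun \<Rightarrow> test_fun" is deriv
proof -
  fix f :: "real \<Rightarrow> real"
  assume f: "smooth_fun f \<and> compact (supp f)"
  have "{x. deriv f x \<noteq> 0} \<subseteq> supp f"
    using deriv_eq_0_outside_supp by blast
  with f show "smooth_fun (deriv f) \<and> compact (supp (deriv f))"
    using smooth_fun_deriv compact_supp_mono[of f] by simp
qed

definition test_converges :: "(nat \<Rightarrow> test_fun) \<Rightarrow> test_fun \<Rightarrow> bool" where
  "test_converges \<Phi> \<phi> \<longleftrightarrow>
     (\<exists>K. compact K \<and> (\<forall>n. supp (fun_of (\<Phi> n)) \<subseteq> K)) \<and>
     (\<forall>k. uniform_limit UNIV (\<lambda>n. fun_of ((test_deriv ^^ k) (\<Phi> n)))
            (fun_of ((test_deriv ^^ k) \<phi>)) sequentially)"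


section \<open>Vector-valued distributions\<close>

definition is_distribution :: "(test_fun \<Rightarrow> 'a::banach) \<Rightarrow> bool" where
  "is_distribution T \<longleftrightarrow> linear T \<and>
     (\<forall>\<Phi> \<phi>. test_converges \<Phi> \<phi> \<longrightarrow> (\<lambda>n. T (\<Phi> n)) \<longlonglongrightarrow> T \<phi>)"

definition dist_deriv :: "(test_fun \<Rightarrow> 'a::banach) \<Rightarrow> test_fun \<Rightarrow> 'a" where
  "dist_deriv T \<phi> = - T (test_deriv \<phi>)"

text \<open>
  The distribution given by a function \<open>f\<close>. It is used for continuous \<open>f\<close> only, where the gauge
  integral exists and needs no separability of the target.
\<close>

definition reg_dist :: "(real \<Rightarrow> 'a::banach) \<Rightarrow> test_fun \<Rightarrow> 'a" where
  "reg_dist f \<phi> = integral UNIV (\<lambda>t. fun_of \<phi> t *\<^sub>R f t)"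

definition TD :: "(test_fun \<Rightarrow> 'a::banach) set" where
  "TD = {T. is_distribution T \<and>
     (\<exists>k g. T = (dist_deriv ^^ k) (reg_dist g) \<and> continuous_on UNIV g \<and>
        (\<forall>t\<le>0. g t = 0) \<and>
        (\<exists>C m. 0 \<le> m \<and> (\<forall>t\<ge>1. norm (g t) \<le> C * t powr m)))}"

text \<open>
  The distributional problem. The first equation lives in \<open>H\<close>-valued distributions, so its left-hand
  side is the derivative of \<open>J \<circ> T\<close>.
\<close>

definition dist_solution ::
  "('v::{real_inner,banach} \<Rightarrow> 'h::{real_inner,banach}) \<Rightarrow> ('v \<Rightarrow> 'h) \<Rightarrow>
   ('m1::{real_inner,banach} \<Rightarrow> 'h) \<Rightarrow> ('v \<Rightarrow> 'm2::{real_inner,banach}) \<Rightarrow>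
   (test_fun \<Rightarrow> 'm1) \<Rightarrow> (test_fun \<Rightarrow> 'm2) \<Rightarrow> (test_fun \<Rightarrow> 'h) \<Rightarrow> (test_fun \<Rightarrow> 'v) \<Rightarrow> bool" where
  "dist_solution J A_star G B \<xi> chi F T \<longleftrightarrow> T \<in> TD \<and>
     dist_deriv (J \<circ> T) = (\<lambda>\<phi>. A_star (T \<phi>) + G (\<xi> \<phi>) + F \<phi>) \<and>
     B \<circ> T = chi"

end

(*
  Existence: the equation expresses A_star applied to the primitive of U through J U and primitives
  of the data, so by the graph norm this primitive grows polynomially in V as soon as J U does in H.
  The latter follows from an energy estimate for U minus the lifting of the boundary data. Hence the
  extension of U is the first derivative of a function admissible in TD(V).
  Uniqueness: regularise the difference T of two solutions to u(t) = T(phi(. - t)). Then u solves the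
  homogeneous problem classically, so its norm in H is constant by skew-symmetry, and u(t) = 0 for
  very negative t because T is supported in the half line.
*)
theory Submission
  imports Defs
begin

section \<open>Test functions\<close>

text \<open>Growth is measured on the primitive because bounding \<open>U\<close> itself in
  \<open>V\<close> would require a bound on \<open>A_star U\<close>, hence on the time derivative of
  \<open>J U\<close>, which the energy estimate does not control. Integrating the equation once
  removes that derivative, at the price of one distributional derivative.

  The lifting solves \<open>J V = A_star V + G \<xi>\<close> with \<open>B V = chi\<close>. After
  subtracting it, \<open>A_star V\<close> and \<open>G \<xi>\<close> combine to \<open>J V\<close>,
  so the boundary data reappear only as a source term built from bounded operators applied to \<Xi>
  and its time derivative. This is where two derivatives of \<Xi> enter: they make the first one
  bounded.

  For uniqueness the obstacle is that the energy identity needs a differentiable curve in Ker B,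
  while T is only a distribution. Translating one fixed test function gives such a curve already in
  \<open>V\<close>, since translation commutes with differentiation and the operators act by
  composition.

  All data and \<open>U\<close> vanish at time 0, so extension by zero produces neither a jump in
  the right-hand side nor a Dirac mass in the derivative.\<close>

lemma fun_of_smooth: "smooth_fun (fun_of \<phi>)"
  and fun_of_compact_supp: "compact (supp (fun_of \<phi>))"
  using fun_of[of \<phi>] by auto

lemma fun_of_has_derivative:
  "(fun_of \<phi> has_real_derivative fun_of (test_deriv \<phi>) x) (at x)"
proof -
  have "(deriv ^^ 0) (fun_of \<phi>) field_differentiable at x"
    using fun_of_smooth[of \<phi>] unfolding smooth_fun_def by blast
  then show ?thesis
    by (simp add: test_deriv.rep_eq field_differentiable_derivI)
qed

lemma continuous_on_fun_of: "continuous_on S (fun_of \<phi>)"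
  by (meson DERIV_isCont continuous_at_imp_continuous_on fun_of_has_derivative)

lemma fun_of_eq_0_outside_supp: "x \<notin> supp (fun_of \<phi>) \<Longrightarrow> fun_of \<phi> x = 0"
  using closure_subset[of "{x. fun_of \<phi> x \<noteq> 0}"] by (auto simp: supp_def)

lemma compact_real_bound:
  assumes "compact (K :: real set)"
  obtains R where "R > 0" "\<And>x. x \<in> K \<Longrightarrow> \<bar>x\<bar> < R"
proof -
  obtain r where "r > 0" "\<And>x. x \<in> K \<Longrightarrow> \<bar>x\<bar> \<le> r"
    using compact_imp_bounded[OF assms] by (auto simp: bounded_pos)
  then show ?thesis by (intro that[of "r + 1"]) force+
qed

lemma fun_of_vanishes_outside:
  obtains R where "R > 0" "\<And>x. \<bar>x\<bar> \<ge> R \<Longrightarrow> fun_of \<phi> x = 0"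
proof -
  obtain R where "R > 0" "\<And>x. x \<in> supp (fun_of \<phi>) \<Longrightarrow> \<bar>x\<bar> < R"
    using compact_real_bound[OF fun_of_compact_supp] by blast
  then show ?thesis
    using fun_of_eq_0_outside_supp[of _ \<phi>] by (intro that[of R]) fastforce+
qed

lemma supp_test_deriv: "supp (fun_of (test_deriv \<phi>)) \<subseteq> supp (fun_of \<phi>)"
  unfolding supp_def[of "fun_of (test_deriv \<phi>)"]
  by (rule closure_minimal)
     (use deriv_eq_0_outside_supp in \<open>auto simp: test_deriv.rep_eq supp_def\<close>)

lemma fun_of_bounded:
  obtains M where "M \<ge> 0" "\<And>x. \<bar>fun_of \<phi> x\<bar> \<le> M"
proof -
  have "bounded (fun_of \<phi> ` supp (fun_of \<phi>))"
    by (intro compact_imp_bounded compact_continuous_image continuous_on_fun_of fun_of_compact_supp)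
  then obtain M where M: "\<And>x. x \<in> supp (fun_of \<phi>) \<Longrightarrow> \<bar>fun_of \<phi> x\<bar> \<le> M"
    by (auto simp: bounded_iff)
  show ?thesis
  proof (rule that[of "\<bar>M\<bar>"])
    show "\<bar>fun_of \<phi> x\<bar> \<le> \<bar>M\<bar>" for x
      using M[of x] fun_of_eq_0_outside_supp[of x \<phi>] by fastforce
  qed simp
qed

lemma fun_of_minus: "fun_of (\<phi> - \<psi>) x = fun_of \<phi> x - fun_of \<psi> x"
  unfolding minus_test_fun_def plus_test_fun.rep_eq scaleR_test_fun.rep_eq by simp

lemma fun_of_uminus: "fun_of (- \<phi>) x = - fun_of \<phi> x"
  unfolding uminus_test_fun_def scaleR_test_fun.rep_eq by simp

lemma test_fun_eqI: "(\<And>x. fun_of \<phi> x = fun_of \<psi> x) \<Longrightarrow> \<phi> = \<psi>"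
  by (metis ext fun_of_inject)

lemma linear_test_deriv: "linear test_deriv"
proof
  show "test_deriv (\<phi> + \<psi>) = test_deriv \<phi> + test_deriv \<psi>" for \<phi> \<psi>
  proof (rule test_fun_eqI)
    fix x
    have "((\<lambda>x. fun_of \<phi> x + fun_of \<psi> x) has_real_derivative
        fun_of (test_deriv \<phi>) x + fun_of (test_deriv \<psi>) x) (at x)"
      by (intro DERIV_add fun_of_has_derivative)
    moreover have "fun_of (\<phi> + \<psi>) = (\<lambda>x. fun_of \<phi> x + fun_of \<psi> x)"
      by (simp add: plus_test_fun.rep_eq)
    ultimately show "fun_of (test_deriv (\<phi> + \<psi>)) x = fun_of (test_deriv \<phi> + test_deriv \<psi>) x"
      using DERIV_unique fun_of_has_derivative by (metis plus_test_fun.rep_eq)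
  qed
  show "test_deriv (c *\<^sub>R \<phi>) = c *\<^sub>R test_deriv \<phi>" for c \<phi>
  proof (rule test_fun_eqI)
    fix x
    have "((\<lambda>x. c * fun_of \<phi> x) has_real_derivative c * fun_of (test_deriv \<phi>) x) (at x)"
      by (intro DERIV_cmult fun_of_has_derivative)
    moreover have "fun_of (c *\<^sub>R \<phi>) = (\<lambda>x. c * fun_of \<phi> x)"
      by (simp add: scaleR_test_fun.rep_eq)
    ultimately show "fun_of (test_deriv (c *\<^sub>R \<phi>)) x = fun_of (c *\<^sub>R test_deriv \<phi>) x"
      using DERIV_unique fun_of_has_derivative by (metis scaleR_test_fun.rep_eq)
  qed
qed

lemma linear_test_deriv_funpow: "linear (test_deriv ^^ k)"
proof (induction k)
  case 0
  show ?case using linear_id by (simp add: id_def)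
next
  case (Suc k)
  then show ?case using linear_compose[OF Suc linear_test_deriv] by (simp add: o_def)
qed

section \<open>Translates of test functions and their difference quotients\<close>

lemma funpow_deriv_shift:
  assumes "smooth_fun f"
  shows "(deriv ^^ n) (\<lambda>x. f (x - t)) = (\<lambda>x. (deriv ^^ n) f (x - t))"
    and "(\<lambda>x. (deriv ^^ n) f (x - t)) field_differentiable (at x)"
proof -
  have der: "((\<lambda>x. (deriv ^^ n) f (x - t)) has_real_derivative deriv ((deriv ^^ n) f) (x - t)) (at x)"
    for n x
  proof -
    have "((deriv ^^ n) f has_real_derivative deriv ((deriv ^^ n) f) (x - t)) (at (x - t))"
      using assms unfolding smooth_fun_def by (blast intro: field_differentiable_derivI)
    moreover have "((\<lambda>x. x - t) has_real_derivative 1) (at x)"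
      by (auto intro!: derivative_eq_intros)
    ultimately show ?thesis
      using DERIV_chain2[of "(deriv ^^ n) f" _ "\<lambda>x. x - t"] by force
  qed
  show "(deriv ^^ n) (\<lambda>x. f (x - t)) = (\<lambda>x. (deriv ^^ n) f (x - t))"
    by (induction n) (use der in \<open>auto intro!: DERIV_imp_deriv\<close>)
  show "(\<lambda>x. (deriv ^^ n) f (x - t)) field_differentiable (at x)"
    using der field_differentiable_def by blast
qed

lemma supp_shift: "supp (\<lambda>x. f (x - t)) = (+) t ` supp f"
proof -
  have "{x. f (x - t) \<noteq> 0} = (+) t ` {x. f x \<noteq> 0}"
    by (auto simp: image_iff) (metis add_diff_cancel_left' diff_add_cancel add.commute)
  then show ?thesis by (simp add: supp_def closure_translation)
qed

lift_definition shift_test :: "real \<Rightarrow> test_fun \<Rightarrow> test_fun" is "\<lambda>t \<phi> x. \<phi> (x - t)"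
  by (simp add: supp_shift compact_translation smooth_fun_def funpow_deriv_shift)

lemma test_deriv_shift: "test_deriv (shift_test t \<phi>) = shift_test t (test_deriv \<phi>)"
  by (rule test_fun_eqI)
     (use funpow_deriv_shift(1)[OF fun_of_smooth, of 1] in
       \<open>simp add: test_deriv.rep_eq shift_test.rep_eq\<close>)

lemma funpow_test_deriv_shift:
  "(test_deriv ^^ k) (shift_test t \<phi>) = shift_test t ((test_deriv ^^ k) \<phi>)"
  by (induction k) (simp_all add: test_deriv_shift)

text \<open>The mean value theorem is applied twice: it turns the quotient into minus \<psi>' at
  some z within |h| of x, and then \<psi>'(z) - \<psi>'(x) into a value of \<psi>'' times z - x. The
  bound does not depend on x, which yields uniform convergence as h tends to 0.\<close>

lemma difference_quotient_bound:
  assumes M: "\<And>x. \<bar>fun_of (test_deriv (test_deriv \<psi>)) x\<bar> \<le> M" and h: "h \<noteq> 0"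
  shows "\<bar>(fun_of \<psi> (x - h) - fun_of \<psi> x) / h + fun_of (test_deriv \<psi>) x\<bar> \<le> M * \<bar>h\<bar>"
proof -
  \<comment> \<open>A mean value theorem for increments of either sign; the weak inequality also
    admits d = 0, which can occur for the second increment z - x.\<close>
  have mv: "\<exists>z. \<bar>z - y\<bar> \<le> \<bar>d\<bar> \<and> fun_of \<theta> (y + d) - fun_of \<theta> y = d * fun_of (test_deriv \<theta>) z"
    for \<theta> y d
  proof (cases d "0::real" rule: linorder_cases)
    case less
    then obtain z where "z > y + d" "z < y"
      "fun_of \<theta> y - fun_of \<theta> (y + d) = (y - (y + d)) * fun_of (test_deriv \<theta>) z"
      using MVT2[of "y + d" y "fun_of \<theta>" "fun_of (test_deriv \<theta>)"] fun_of_has_derivative by auto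
    then show ?thesis using less by (intro exI[of _ z]) auto
  next
    case greater
    then obtain z where "z < y + d" "z > y"
      "fun_of \<theta> (y + d) - fun_of \<theta> y = ((y + d) - y) * fun_of (test_deriv \<theta>) z"
      using MVT2[of y "y + d" "fun_of \<theta>" "fun_of (test_deriv \<theta>)"] fun_of_has_derivative by auto
    then show ?thesis using greater by (intro exI[of _ z]) auto
  qed auto
  obtain z where z: "\<bar>z - x\<bar> \<le> \<bar>h\<bar>"
      "fun_of \<psi> (x - h) - fun_of \<psi> x = - h * fun_of (test_deriv \<psi>) z"
    using mv[of x "-h" \<psi>] by auto
  obtain w where w: "fun_of (test_deriv \<psi>) z - fun_of (test_deriv \<psi>) x
      = (z - x) * fun_of (test_deriv (test_deriv \<psi>)) w"
    using mv[of x "z - x" "test_deriv \<psi>"] by auto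
  have "(fun_of \<psi> (x - h) - fun_of \<psi> x) / h + fun_of (test_deriv \<psi>) x
      = - ((z - x) * fun_of (test_deriv (test_deriv \<psi>)) w)"
  proof -
    have "(fun_of \<psi> (x - h) - fun_of \<psi> x) / h = - fun_of (test_deriv \<psi>) z"
      using h z(2) by simp
    then show ?thesis using w by simp
  qed
  also have "\<bar>\<dots>\<bar> \<le> \<bar>h\<bar> * M"
    using z(1) M[of w] by (simp add: abs_mult mult_mono)
  finally show ?thesis by (simp add: mult.commute)
qed

text \<open>Differentiating \<phi>(x - t) in t gives the minus sign. The k-th derivative of the
  quotient is the quotient formed with \<psi>, the k-th derivative of \<phi>, so a single estimate
  covers every order of differentiation.\<close>

lemma test_converges_difference_quotient:
  assumes h: "h \<longlonglongrightarrow> 0" "\<And>n. h n \<noteq> 0"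
  shows "test_converges (\<lambda>n. (1 / h n) *\<^sub>R (shift_test (t + h n) \<phi> - shift_test t \<phi>))
           (- shift_test t (test_deriv \<phi>))"
  unfolding test_converges_def
proof (intro conjI allI)
  obtain R where R: "R > 0" "\<And>x. x \<in> supp (fun_of \<phi>) \<Longrightarrow> \<bar>x\<bar> < R"
    using compact_real_bound[OF fun_of_compact_supp] by blast
  \<comment> \<open>A convergent sequence of shifts is bounded; this keeps all translated supports
    in one compact interval.\<close>
  obtain c where c: "\<And>n. \<bar>h n\<bar> \<le> c"
    using convergent_imp_bounded[OF h(1)] by (auto simp: bounded_iff)
  have zero: "fun_of \<phi> x = 0" if "\<bar>x\<bar> \<ge> R" for x
    using R(2)[of x] that fun_of_eq_0_outside_supp[of x \<phi>] by fastforce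
  show "\<exists>K. compact K \<and>
      (\<forall>n. supp (fun_of ((1 / h n) *\<^sub>R (shift_test (t + h n) \<phi> - shift_test t \<phi>))) \<subseteq> K)"
  proof (intro exI[of _ "{-(R + \<bar>t\<bar> + c)..R + \<bar>t\<bar> + c}"] conjI allI)
    fix n
    show "supp (fun_of ((1 / h n) *\<^sub>R (shift_test (t + h n) \<phi> - shift_test t \<phi>)))
        \<subseteq> {-(R + \<bar>t\<bar> + c)..R + \<bar>t\<bar> + c}"
      unfolding supp_def
    proof (rule closure_minimal)
      show "{x. fun_of ((1 / h n) *\<^sub>R (shift_test (t + h n) \<phi> - shift_test t \<phi>)) x \<noteq> 0}
          \<subseteq> {-(R + \<bar>t\<bar> + c)..R + \<bar>t\<bar> + c}"
      proof
        fix x assume "x \<in> {x. fun_of ((1 / h n) *\<^sub>R (shift_test (t + h n) \<phi> - shift_test t \<phi>)) x \<noteq> 0}"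
        then have "fun_of \<phi> (x - (t + h n)) \<noteq> 0 \<or> fun_of \<phi> (x - t) \<noteq> 0"
          by (auto simp: scaleR_test_fun.rep_eq fun_of_minus shift_test.rep_eq)
        then have "\<bar>x - (t + h n)\<bar> < R \<or> \<bar>x - t\<bar> < R"
          using zero by (meson not_le)
        then show "x \<in> {-(R + \<bar>t\<bar> + c)..R + \<bar>t\<bar> + c}"
          using c[of n] by auto
      qed
    qed simp
  qed simp
  fix k
  define \<psi> where "\<psi> = (test_deriv ^^ k) \<phi>"
  have lin: "linear (test_deriv ^^ k)" by (rule linear_test_deriv_funpow)
  have swap: "(test_deriv ^^ k) (test_deriv \<phi>) = test_deriv \<psi>"
    by (simp add: \<psi>_def funpow_swap1)
  have eq1: "(test_deriv ^^ k) ((1 / h n) *\<^sub>R (shift_test (t + h n) \<phi> - shift_test t \<phi>))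
      = (1 / h n) *\<^sub>R (shift_test (t + h n) \<psi> - shift_test t \<psi>)" for n
    by (simp add: linear_scale[OF lin] linear_diff[OF lin] funpow_test_deriv_shift \<psi>_def)
  have eq2: "(test_deriv ^^ k) (- shift_test t (test_deriv \<phi>)) = - shift_test t (test_deriv \<psi>)"
    by (simp add: linear_neg[OF lin] funpow_test_deriv_shift swap)
  obtain M where M: "M \<ge> 0" "\<And>x. \<bar>fun_of (test_deriv (test_deriv \<psi>)) x\<bar> \<le> M"
    using fun_of_bounded by blast
  have bound: "dist (fun_of ((1 / h n) *\<^sub>R (shift_test (t + h n) \<psi> - shift_test t \<psi>)) x)
      (fun_of (- shift_test t (test_deriv \<psi>)) x) \<le> M * \<bar>h n\<bar>" for n x
    using difference_quotient_bound[OF M(2) h(2), where x = "x - t"]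
    by (simp add: dist_real_def scaleR_test_fun.rep_eq fun_of_minus fun_of_uminus
        shift_test.rep_eq diff_diff_eq)
  have "(\<lambda>n. M * \<bar>h n\<bar>) \<longlonglongrightarrow> M * \<bar>0\<bar>"
    by (intro tendsto_intros h(1))
  then have lim: "(\<lambda>n. M * \<bar>h n\<bar>) \<longlonglongrightarrow> 0" by simp
  show "uniform_limit UNIV
     (\<lambda>n. fun_of ((test_deriv ^^ k) ((1 / h n) *\<^sub>R (shift_test (t + h n) \<phi> - shift_test t \<phi>))))
     (fun_of ((test_deriv ^^ k) (- shift_test t (test_deriv \<phi>)))) sequentially"
    unfolding eq1 eq2 uniform_limit_iff
  proof (intro allI impI)
    fix e :: real assume "e > 0"
    with lim have "\<forall>\<^sub>F n in sequentially. M * \<bar>h n\<bar> < e"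
      by (rule order_tendstoD)
    then show "\<forall>\<^sub>F n in sequentially. \<forall>x\<in>UNIV.
      dist (fun_of ((1 / h n) *\<^sub>R (shift_test (t + h n) \<psi> - shift_test t \<psi>)) x)
        (fun_of (- shift_test t (test_deriv \<psi>)) x) < e"
      by eventually_elim (intro ballI le_less_trans[OF bound])
  qed
qed


section \<open>Mollification and uniqueness\<close>

text \<open>A limit at a point can be tested along sequences, so sequential continuity of T carries
  the convergence of difference quotients over to the target space. Thus t \<mapsto> T(\<phi>(. -
  t)) is classically differentiable, and its derivative is the same mollification of the
  distributional derivative.\<close>

lemma distribution_shift_has_vector_derivative:
  fixes T :: "test_fun \<Rightarrow> 'a::banach"
  assumes "is_distribution T"
  shows "((\<lambda>s. T (shift_test s \<phi>)) has_vector_derivative dist_deriv T (shift_test t \<phi>)) (at t)"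
proof -
  have lin: "linear T" using assms by (simp add: is_distribution_def)
  define D where "D = T (- shift_test t (test_deriv \<phi>))"
  have D: "dist_deriv T (shift_test t \<phi>) = D"
    by (simp add: dist_deriv_def D_def linear_neg[OF lin] test_deriv_shift)
  have "((\<lambda>h. (1 / h) *\<^sub>R (T (shift_test (t + h) \<phi>) - T (shift_test t \<phi>))) \<longlongrightarrow> D) (at 0)"
    unfolding tendsto_at_iff_sequentially
  proof (intro allI impI)
    fix h :: "nat \<Rightarrow> real" assume "\<forall>i. h i \<in> UNIV - {0}" "h \<longlonglongrightarrow> 0"
    then have "(\<lambda>n. T ((1 / h n) *\<^sub>R (shift_test (t + h n) \<phi> - shift_test t \<phi>))) \<longlonglongrightarrow> D"
      using assms test_converges_difference_quotient[of h t \<phi>]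
      unfolding is_distribution_def D_def by blast
    then show "((\<lambda>h. (1 / h) *\<^sub>R (T (shift_test (t + h) \<phi>) - T (shift_test t \<phi>))) \<circ> h) \<longlonglongrightarrow> D"
      by (simp add: o_def linear_scale[OF lin] linear_diff[OF lin])
  qed
  then have "((\<lambda>h. norm ((1 / h) *\<^sub>R (T (shift_test (t + h) \<phi>) - T (shift_test t \<phi>)) - D)) \<longlongrightarrow> 0) (at 0)"
    by (intro tendsto_norm_zero) (simp add: LIM_zero)
  moreover have "\<forall>\<^sub>F h in at 0.
      norm ((1 / h) *\<^sub>R (T (shift_test (t + h) \<phi>) - T (shift_test t \<phi>)) - D)
      = norm (T (shift_test (t + h) \<phi>) - T (shift_test t \<phi>) - h *\<^sub>R D) / norm h"
    unfolding eventually_at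
  proof (intro exI[of _ 1] conjI ballI impI)
    fix h :: real assume h: "h \<noteq> 0 \<and> dist h 0 < 1"
    then have "(1 / h) *\<^sub>R (T (shift_test (t + h) \<phi>) - T (shift_test t \<phi>)) - D
      = (1 / h) *\<^sub>R (T (shift_test (t + h) \<phi>) - T (shift_test t \<phi>) - h *\<^sub>R D)"
      by (simp add: scaleR_diff_right)
    then show "norm ((1 / h) *\<^sub>R (T (shift_test (t + h) \<phi>) - T (shift_test t \<phi>)) - D)
      = norm (T (shift_test (t + h) \<phi>) - T (shift_test t \<phi>) - h *\<^sub>R D) / norm h"
      by simp
  qed simp
  ultimately have "((\<lambda>h. norm (T (shift_test (t + h) \<phi>) - T (shift_test t \<phi>) - h *\<^sub>R D) / norm h)
      \<longlongrightarrow> 0) (at 0)"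
    by (rule Lim_transform_eventually)
  then show ?thesis
    unfolding D has_vector_derivative_def has_derivative_at
    by (simp add: bounded_linear_scaleR_left)
qed

text \<open>Distributional differentiation does not enlarge supports, so the claim passes from g to
  all its derivatives. It supplies the initial condition for the uniqueness argument.\<close>

lemma TD_vanishes_on_negative:
  assumes "T \<in> TD" and "supp (fun_of \<phi>) \<subseteq> {..<0}"
  shows "T \<phi> = 0"
proof -
  obtain k g where T: "T = (dist_deriv ^^ k) (reg_dist g)" and g: "\<And>t. t \<le> 0 \<Longrightarrow> g t = 0"
    using assms(1) unfolding TD_def by blast
  have "(dist_deriv ^^ k) (reg_dist g) \<phi> = 0"
    using assms(2)
  proof (induction k arbitrary: \<phi>)
    case 0
    have "(\<lambda>t. fun_of \<phi> t *\<^sub>R g t) = (\<lambda>t. 0)"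
    proof
      fix t
      show "fun_of \<phi> t *\<^sub>R g t = 0"
        using g[of t] 0 fun_of_eq_0_outside_supp[of t \<phi>] by (cases "t \<le> 0") fastforce+
    qed
    then show ?case by (simp add: reg_dist_def)
  next
    case (Suc k)
    then show ?case
      using supp_test_deriv[of \<phi>] by (simp add: dist_deriv_def)
  qed
  with T show ?thesis by simp
qed

lemma (in evolution_framework) dist_solution_unique:
  assumes "dist_solution J A_star G B \<xi> chi F T1" "dist_solution J A_star G B \<xi> chi F T2"
  shows "T1 = T2"
proof
  fix \<phi>
  define u where "u t = T1 (shift_test t \<phi>) - T2 (shift_test t \<phi>)" for t
  note sol = assms[unfolded dist_solution_def]
  interpret J: bounded_linear J by (rule embedding)
  interpret A: bounded_linear A_star by (rule bounded_linear_A_star)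
  interpret B: bounded_linear B by (rule bounded_linear_B)
  have TD: "is_distribution T1" "is_distribution T2"
    using sol by (auto simp: TD_def)
  have eq: "dist_deriv (J \<circ> T1) \<psi> - dist_deriv (J \<circ> T2) \<psi> = A_star (T1 \<psi> - T2 \<psi>)" for \<psi>
    using sol by (simp add: A.diff)
  have Bu: "B (u t) = 0" for t
    using sol unfolding u_def B.diff by (metis comp_apply diff_self)
  \<comment> \<open>The curve is differentiable in \<open>V\<close>; \<open>J\<close> carries the
    derivative to \<open>H\<close>, where the difference of the two equations, tested with the
    translate, identifies it.\<close>
  have der: "((\<lambda>s. J (u s)) has_vector_derivative A_star (u t)) (at t)" for t
  proof -
    have "((\<lambda>s. T1 (shift_test s \<phi>) - T2 (shift_test s \<phi>)) has_vector_derivative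
        dist_deriv T1 (shift_test t \<phi>) - dist_deriv T2 (shift_test t \<phi>)) (at t)"
      by (intro has_vector_derivative_diff distribution_shift_has_vector_derivative TD)
    from J.has_vector_derivative[OF this] show ?thesis
      using eq[of "shift_test t \<phi>"] by (simp add: u_def dist_deriv_def J.diff J.neg)
  qed
  \<comment> \<open>The derivative is twice the product of \<open>A_star (u t)\<close> with
    \<open>J (u t)\<close>, which vanishes because \<open>u t\<close> lies in Ker B.\<close>
  have "((\<lambda>s. J (u s) \<bullet> J (u s)) has_vector_derivative 0) (at t)" for t
    using bounded_bilinear.has_vector_derivative[OF bounded_bilinear_inner der der, of t]
      skew[OF Bu, of t] by (simp add: inner_commute)
  then have const: "J (u s) \<bullet> J (u s) = J (u t) \<bullet> J (u t)" for s t
    using has_vector_derivative_zero_constant[of UNIV "\<lambda>s. J (u s) \<bullet> J (u s)"] by force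
  obtain R where R: "R > 0" "\<And>x. x \<in> supp (fun_of \<phi>) \<Longrightarrow> \<bar>x\<bar> < R"
    using compact_real_bound[OF fun_of_compact_supp] by blast
  \<comment> \<open>The support of \<phi> lies in (-R, R), so moving it left by R places it in (-2R,
    0).\<close>
  have "supp (fun_of (shift_test (- R) \<phi>)) \<subseteq> {..<0}"
  proof -
    have "supp (fun_of (shift_test (- R) \<phi>)) = (+) (- R) ` supp (fun_of \<phi>)"
      by (simp only: shift_test.rep_eq supp_shift)
    then show ?thesis
      by (auto dest: R(2))
  qed
  then have "u (- R) = 0"
    using TD_vanishes_on_negative sol unfolding u_def by (metis diff_self)
  then have "J (u 0) = J 0"
    using const[of 0 "- R"] by (simp add: J.zero)
  then have "u 0 = 0"
    by (rule injD[OF embedding(2)])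
  \<comment> \<open>The value of the curve at time 0 is the difference of the distributions at
    \<phi> itself, so no limit of mollifiers has to be taken.\<close>
  moreover have "shift_test 0 \<phi> = \<phi>"
    by (rule test_fun_eqI) (simp add: shift_test.rep_eq)
  ultimately show "T1 \<phi> = T2 \<phi>" by (simp add: u_def)
qed


section \<open>Distributions given by continuous functions\<close>

text \<open>The value of \<open>integral\<close> is meaningful only for an integrable function;
  continuity on a compact interval containing the support secures this. The compact form serves
  estimates and integration by parts, the form on \<open>UNIV\<close> serves algebra with test
  functions of different supports.\<close>

lemma reg_dist_has_integral:
  assumes f: "continuous_on UNIV f" and R: "\<And>x. \<bar>x\<bar> > R \<Longrightarrow> fun_of \<phi> x = 0"
  shows "((\<lambda>t. fun_of \<phi> t *\<^sub>R f t) has_integral reg_dist f \<phi>) {-R..R}"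
    and "((\<lambda>t. fun_of \<phi> t *\<^sub>R f t) has_integral reg_dist f \<phi>) UNIV"
proof -
  define h where "h t = fun_of \<phi> t *\<^sub>R f t" for t
  have "continuous_on {-R..R} h"
    unfolding h_def by (rule continuous_on_scaleR[OF continuous_on_fun_of continuous_on_subset[OF f subset_UNIV]])
  then have h: "(h has_integral integral {-R..R} h) {-R..R}"
    by (intro integrable_integral integrable_continuous_real)
  have "h t = 0" if "t \<notin> {-R..R}" for t
    using R[of t] that by (cases "\<bar>t\<bar> > R") (auto simp: h_def)
  then have h': "(h has_integral integral {-R..R} h) UNIV"
    by (intro has_integral_on_superset[OF h]) simp_all
  then have "reg_dist f \<phi> = integral {-R..R} h"
    by (simp add: reg_dist_def h_def[symmetric] integral_unique)
  with h h' show "((\<lambda>t. fun_of \<phi> t *\<^sub>R f t) has_integral reg_dist f \<phi>) {-R..R}"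
    "((\<lambda>t. fun_of \<phi> t *\<^sub>R f t) has_integral reg_dist f \<phi>) UNIV"
    by (simp_all add: h_def[abs_def])
qed

lemma reg_dist_has_integral_UNIV:
  assumes "continuous_on UNIV f"
  shows "((\<lambda>t. fun_of \<phi> t *\<^sub>R f t) has_integral reg_dist f \<phi>) UNIV"
proof -
  obtain R where "R > 0" "\<And>x. \<bar>x\<bar> \<ge> R \<Longrightarrow> fun_of \<phi> x = 0"
    using fun_of_vanishes_outside by blast
  then show ?thesis using reg_dist_has_integral(2)[OF assms, of R] by simp
qed

lemma linear_reg_dist:
  assumes f: "continuous_on UNIV f"
  shows "linear (reg_dist f)"
proof
  note I = reg_dist_has_integral_UNIV[OF f]
  show "reg_dist f (\<phi> + \<psi>) = reg_dist f \<phi> + reg_dist f \<psi>" for \<phi> \<psi>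
    using has_integral_unique[OF I[of "\<phi> + \<psi>"]] has_integral_add[OF I[of \<phi>] I[of \<psi>]]
    by (simp add: plus_test_fun.rep_eq scaleR_add_left)
  show "reg_dist f (c *\<^sub>R \<phi>) = c *\<^sub>R reg_dist f \<phi>" for c \<phi>
    using has_integral_unique[OF I[of "c *\<^sub>R \<phi>"]] has_integral_cmul[OF I[of \<phi>], of c]
    by (simp add: scaleR_test_fun.rep_eq)
qed

lemma reg_dist_norm_bound:
  assumes f: "continuous_on UNIV f" and R: "R \<ge> 0" "\<And>x. \<bar>x\<bar> > R \<Longrightarrow> fun_of \<phi> x = 0"
    and M: "\<And>x. x \<in> {-R..R} \<Longrightarrow> norm (f x) \<le> M" and e: "\<And>x. \<bar>fun_of \<phi> x\<bar> \<le> e"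
  shows "norm (reg_dist f \<phi>) \<le> e * M * (2 * R)"
proof -
  have "e \<ge> 0" using e[of 0] by simp
  have "M \<ge> 0" using M[of 0] R(1) order_trans[OF norm_ge_zero[of "f 0"]] by simp
  have bound: "norm (fun_of \<phi> x *\<^sub>R f x) \<le> e * M" if "x \<in> {-R..R}" for x
    using e[of x] M[OF that] \<open>e \<ge> 0\<close> by (simp add: mult_mono)
  have "((\<lambda>t. fun_of \<phi> t *\<^sub>R f t) has_integral reg_dist f \<phi>) {-R..R}"
    using R(2) by (rule reg_dist_has_integral(1)[OF f])
  with mult_nonneg_nonneg[OF \<open>e \<ge> 0\<close> \<open>M \<ge> 0\<close>] finite.emptyI
  have "norm (reg_dist f \<phi>) \<le> e * M * measure lborel {-R..R}"
    by (rule has_integral_bound_real) (simp add: bound del: norm_scaleR)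
  then show ?thesis using R(1) by simp
qed

lemma is_distribution_reg_dist:
  assumes f: "continuous_on UNIV f"
  shows "is_distribution (reg_dist f)"
  unfolding is_distribution_def
proof (intro conjI allI impI)
  note lin = linear_reg_dist[OF f]
  show "linear (reg_dist f)" by (rule lin)
  fix \<Phi> \<phi> assume conv: "test_converges \<Phi> \<phi>"
  then obtain K where "compact K" and K: "\<And>n. supp (fun_of (\<Phi> n)) \<subseteq> K"
    unfolding test_converges_def by blast
  then obtain R0 where R0: "R0 > 0" "\<And>x. x \<in> K \<Longrightarrow> \<bar>x\<bar> < R0"
    using compact_real_bound by blast
  obtain R1 where R1: "R1 > 0" "\<And>x. \<bar>x\<bar> \<ge> R1 \<Longrightarrow> fun_of \<phi> x = 0"
    using fun_of_vanishes_outside by blast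
  define R where "R = max R0 R1"
  have R: "R \<ge> 0" using R0 by (simp add: R_def)
  have out: "fun_of (\<Phi> n - \<phi>) x = 0" if "\<bar>x\<bar> > R" for n x
  proof -
    have "x \<notin> supp (fun_of (\<Phi> n))" using R0(2)[of x] K[of n] that by (auto simp: R_def)
    then show ?thesis
      using R1(2)[of x] that by (simp add: fun_of_minus fun_of_eq_0_outside_supp R_def)
  qed
  have "bounded (f ` {-R..R})"
    by (intro compact_imp_bounded compact_continuous_image continuous_on_subset[OF f]) auto
  then obtain M where M: "M > 0" "\<And>x. x \<in> {-R..R} \<Longrightarrow> norm (f x) \<le> M"
    by (auto simp: bounded_pos)
  \<comment> \<open>A continuous function defines a distribution of order zero, so the estimate
    works with k = 0 and the common compact support.\<close>
  have "uniform_limit UNIV (\<lambda>n. fun_of ((test_deriv ^^ 0) (\<Phi> n))) (fun_of ((test_deriv ^^ 0) \<phi>)) sequentially"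
    using conv unfolding test_converges_def by blast
  then have unif: "uniform_limit UNIV (\<lambda>n. fun_of (\<Phi> n)) (fun_of \<phi>) sequentially" by simp
  show "(\<lambda>n. reg_dist f (\<Phi> n)) \<longlonglongrightarrow> reg_dist f \<phi>"
  proof (rule tendstoI)
    fix e :: real assume "e > 0"
    \<comment> \<open>The summand 1 makes the final inequality strict: d * M * 2R equals e -
      d.\<close>
    define d where "d = e / (M * (2 * R) + 1)"
    have pos: "M * (2 * R) + 1 > 0" using M R by (simp add: add_nonneg_pos)
    then have d: "d > 0" using \<open>e > 0\<close> by (simp add: d_def)
    have "d * (M * (2 * R) + 1) = e" using pos by (simp add: d_def)
    then have small: "d * M * (2 * R) < e" using d by (simp add: algebra_simps)
    from uniform_limitD[OF unif d]
    show "\<forall>\<^sub>F n in sequentially. dist (reg_dist f (\<Phi> n)) (reg_dist f \<phi>) < e"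
    proof eventually_elim
      case (elim n)
      then have "\<bar>fun_of (\<Phi> n - \<phi>) x\<bar> \<le> d" for x
        by (simp add: fun_of_minus dist_real_def less_imp_le)
      then have "norm (reg_dist f (\<Phi> n - \<phi>)) \<le> d * M * (2 * R)"
        by (intro reg_dist_norm_bound f R out M)
      then show ?case
        using small by (simp add: dist_norm linear_diff[OF lin])
    qed
  qed
qed

lemma bounded_linear_reg_dist:
  assumes "bounded_linear L" "continuous_on UNIV f"
  shows "L (reg_dist f \<phi>) = reg_dist (\<lambda>t. L (f t)) \<phi>"
proof -
  interpret L: bounded_linear L by fact
  have "((\<lambda>t. fun_of \<phi> t *\<^sub>R L (f t)) has_integral L (reg_dist f \<phi>)) UNIV"
    using has_integral_linear[OF reg_dist_has_integral_UNIV[OF assms(2)] assms(1)]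
    by (simp add: o_def L.scaleR)
  then show ?thesis by (simp add: reg_dist_def integral_unique)
qed

lemma reg_dist_add:
  assumes "continuous_on UNIV f" "continuous_on UNIV g"
  shows "reg_dist (\<lambda>t. f t + g t) \<phi> = reg_dist f \<phi> + reg_dist g \<phi>"
  using has_integral_add[OF reg_dist_has_integral_UNIV[OF assms(1)] reg_dist_has_integral_UNIV[OF assms(2)], of \<phi> \<phi>]
  by (simp add: reg_dist_def[of "\<lambda>t. f t + g t"] scaleR_add_right integral_unique)

text \<open>Integration by parts on [-R, R], with boundary terms killed by \<phi>(R) = \<phi>(-R) =
  0. The exceptional set S accommodates time 0, where an extension by zero is glued
  together.\<close>

lemma dist_deriv_reg_dist:
  assumes f: "continuous_on UNIV f" and f': "continuous_on UNIV f'"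
    and S: "finite S" and der: "\<And>t. t \<notin> S \<Longrightarrow> (f has_vector_derivative f' t) (at t)"
  shows "dist_deriv (reg_dist f) = reg_dist f'"
proof
  fix \<phi>
  obtain R where R: "R > 0" "\<And>x. \<bar>x\<bar> \<ge> R \<Longrightarrow> fun_of \<phi> x = 0"
    using fun_of_vanishes_outside by blast
  \<comment> \<open>The strict inequality ensures that \<phi> vanishes in a whole neighbourhood of
    x.\<close>
  have R': "fun_of (test_deriv \<phi>) x = 0" if "\<bar>x\<bar> > R" for x
  proof -
    have "open ({R<..} \<union> {..<-R})" "x \<in> {R<..} \<union> {..<-R}"
      using that by auto
    moreover have "fun_of \<phi> y = 0" if "y \<in> {R<..} \<union> {..<-R}" for y
      using that R by auto
    ultimately have "\<forall>\<^sub>F y in nhds x. fun_of \<phi> y = 0"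
      unfolding eventually_nhds by blast
    then have "deriv (fun_of \<phi>) x = deriv (\<lambda>y. 0) x"
      by (rule deriv_cong_ev) simp
    then show ?thesis by (simp add: test_deriv.rep_eq)
  qed
  have "((\<lambda>t. fun_of (test_deriv \<phi>) t *\<^sub>R f t) has_integral
      fun_of \<phi> R *\<^sub>R f R - fun_of \<phi> (-R) *\<^sub>R f (-R) - reg_dist f' \<phi>) {-R..R}"
  proof (rule integration_by_parts_interior_strong[OF bounded_bilinear_scaleR S])
    show "((\<lambda>t. fun_of \<phi> t *\<^sub>R f' t) has_integral
        fun_of \<phi> R *\<^sub>R f R - fun_of \<phi> (- R) *\<^sub>R f (- R) -
        (fun_of \<phi> R *\<^sub>R f R - fun_of \<phi> (- R) *\<^sub>R f (- R) - reg_dist f' \<phi>)) {-R..R}"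
      using reg_dist_has_integral(1)[OF f', of R \<phi>] R by simp
    show "(fun_of \<phi> has_vector_derivative fun_of (test_deriv \<phi>) x) (at x)" for x
      using fun_of_has_derivative by (simp add: has_real_derivative_iff_has_vector_derivative)
  qed (use R f der in \<open>auto intro: continuous_on_fun_of continuous_on_subset\<close>)
  then show "dist_deriv (reg_dist f) \<phi> = reg_dist f' \<phi>"
    using has_integral_unique[OF reg_dist_has_integral(1)[OF f R']] R
    by (simp add: dist_deriv_def)
qed


section \<open>Functions on the half line\<close>

lemma continuous_on_ext0:
  fixes f :: "real \<Rightarrow> 'a::real_normed_vector"
  assumes "continuous_on {0..} f" "f 0 = 0"
  shows "continuous_on UNIV (ext0 f)"
proof -
  have "ext0 f = (\<lambda>t. f (max 0 t))"
    using assms(2) by (auto simp: ext0_def max_def)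
  moreover have "continuous_on UNIV (\<lambda>t. f (max 0 t))"
    by (rule continuous_on_compose2[OF assms(1)]) (auto intro!: continuous_intros)
  ultimately show ?thesis by simp
qed

lemma ext0_has_vector_derivative:
  fixes f :: "real \<Rightarrow> 'a::real_normed_vector"
  assumes "\<And>t. t > 0 \<Longrightarrow> (f has_vector_derivative f' t) (at t within {0..})" and "t \<noteq> 0"
  shows "(ext0 f has_vector_derivative ext0 f' t) (at t)"
proof (cases "t > 0")
  case True
  then have "(f has_vector_derivative f' t) (at t)"
    using assms(1)[of t] at_within_interior[of t "{0..}"] by simp
  then have "(ext0 f has_vector_derivative f' t) (at t)"
    by (rule has_vector_derivative_transform_within_open[where S = "{0<..}"])
       (use True in \<open>auto simp: ext0_def\<close>)
  then show ?thesis using True by (simp add: ext0_def)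
next
  case False
  have "((\<lambda>t. 0) has_vector_derivative 0) (at t)" by simp
  then have "(ext0 f has_vector_derivative 0) (at t)"
    by (rule has_vector_derivative_transform_within_open[where S = "{..<0}"])
       (use False assms(2) in \<open>auto simp: ext0_def\<close>)
  then show ?thesis using False assms(2) by (simp add: ext0_def)
qed

text \<open>The condition \<open>f 0 = 0\<close> excludes a Dirac mass at the origin, and
  \<open>f' 0 = 0\<close> keeps the extended derivative continuous.\<close>

lemma dist_deriv_reg_dist_ext0:
  assumes "\<And>t. t \<ge> 0 \<Longrightarrow> (f has_vector_derivative f' t) (at t within {0..})"
    and "continuous_on {0..} f'" "f 0 = 0" "f' 0 = 0"
  shows "dist_deriv (reg_dist (ext0 f)) = reg_dist (ext0 f')"
proof (rule dist_deriv_reg_dist[of _ _ "{0}"])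
  have "continuous_on {0..} f"
    using assms(1) by (intro continuous_on_vector_derivative) auto
  then show "continuous_on UNIV (ext0 f)" by (intro continuous_on_ext0 assms)
qed (use assms in \<open>auto intro: continuous_on_ext0 ext0_has_vector_derivative\<close>)

section \<open>Bounds for data in W^1 and W^2\<close>

lemma C_half_1_has_vector_derivative:
  assumes "C_half 1 f" "t \<ge> 0"
  shows "(f has_vector_derivative half_deriv f t) (at t within {0..})"
  using assms unfolding C_half_def half_deriv_def by (auto simp: vector_derivative_works)

text \<open>The bound is the L^1 norm of g over the whole half line, hence uniform in t.\<close>

lemma L1_on_primitive_bounded:
  assumes "L1_on {0<..} g" and "\<And>t. t \<ge> 0 \<Longrightarrow> (g has_integral f t) {0..t}"
  obtains M where "M \<ge> 0" "\<And>t. t \<ge> 0 \<Longrightarrow> norm (f t) \<le> M"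
proof (rule that[of "integral {0..} (\<lambda>t. norm (g t))"])
  have "(\<lambda>t. norm (g t)) integrable_on {0<..}"
    using assms(1) by (intro integrable_on_lebesgue_on) (auto simp: L1_on_def)
  \<comment> \<open>The open and the closed half line differ only in the point 0, a null
    set.\<close>
  then have int: "(\<lambda>t. norm (g t)) integrable_on {0..}"
    by (rule integrable_spike_set) (auto intro: negligible_subset[of "{0::real}"])
  show "integral {0..} (\<lambda>t. norm (g t)) \<ge> 0"
    by (intro integral_nonneg int) simp
  fix t :: real assume t: "t \<ge> 0"
  have int_t: "(\<lambda>t. norm (g t)) integrable_on {0..t}"
    using int by (rule integrable_on_subinterval) auto
  have "norm (f t) = norm (integral {0..t} g)"
    using assms(2)[OF t] by (simp add: integral_unique)
  also have "\<dots> \<le> integral {0..t} (\<lambda>t. norm (g t))"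
    using assms(2)[OF t] int_t by (intro integral_norm_bound_integral) auto
  also have "\<dots> \<le> integral {0..} (\<lambda>t. norm (g t))"
    by (intro integral_subset_le int int_t) auto
  finally show "norm (f t) \<le> integral {0..} (\<lambda>t. norm (g t))" .
qed

lemma W_half_1D:
  assumes "W_half 1 f"
  shows "continuous_on {0..} f" "f 0 = 0" "\<exists>M\<ge>0. \<forall>t\<ge>0. norm (f t) \<le> M"
proof -
  show f: "continuous_on {0..} f" "f 0 = 0"
    using assms by (auto simp: W_half_def C_half_def)
  obtain g where "L1_on {0<..} g" "\<And>t. t \<ge> 0 \<Longrightarrow> (g has_integral f t) {0..t}"
    using assms f(2) by (auto simp: W_half_def)
  then show "\<exists>M\<ge>0. \<forall>t\<ge>0. norm (f t) \<le> M"
    using L1_on_primitive_bounded by metis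
qed

lemma W_half_2D:
  assumes "W_half 2 f"
  shows "C_half 1 f" "f 0 = 0" "W_half 1 (half_deriv f)"
  using assms by (auto simp: W_half_def C_half_def numeral_2_eq_2)

lemma derivative_bound_linear_growth:
  fixes f :: "real \<Rightarrow> 'a::banach"
  assumes "\<And>t. t \<ge> 0 \<Longrightarrow> (f has_vector_derivative f' t) (at t within {0..})" "f 0 = 0"
    and "\<And>t. t \<ge> 0 \<Longrightarrow> norm (f' t) \<le> M" and t: "t \<ge> 0"
  shows "norm (f t) \<le> M * t"
proof -
  have "(f' has_integral (f t - f 0)) {0..t}"
    using t
    by (intro fundamental_theorem_of_calculus has_vector_derivative_within_subset[OF assms(1)]) auto
  moreover have "M \<ge> 0" using assms(3)[of 0] norm_ge_zero[of "f' 0"] by linarith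
  ultimately show ?thesis
    using has_integral_bound_real[of M "{}" f' "f t - f 0" 0 t] assms by simp
qed

text \<open>Apply the mean value theorem to \<open>\<parallel>w\<parallel>\<^sup>2\<close> on \<open>[0, s]\<close>, where \<open>s\<close> maximises \<open>\<parallel>w\<parallel>\<close> on \<open>[0, T]\<close>.\<close>

lemma energy_estimate:
  fixes w :: "real \<Rightarrow> 'a::real_inner"
  assumes der: "\<And>t. t \<ge> 0 \<Longrightarrow> (w has_vector_derivative w' t) (at t within {0..})" and "w 0 = 0"
    and k: "\<And>t. 0 \<le> t \<Longrightarrow> t \<le> T \<Longrightarrow> w t \<bullet> w' t \<le> k * norm (w t)" and "T \<ge> 0" "k \<ge> 0"
  shows "norm (w T) \<le> 2 * T * k"
proof -
  have "continuous_on {0..} w"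
    using der by (intro continuous_on_vector_derivative) auto
  then have "continuous_on {0..T} w"
    by (rule continuous_on_subset) auto
  then have "continuous_on {0..T} (\<lambda>t. norm (w t))"
    by (rule continuous_on_norm)
  then obtain s where s: "0 \<le> s" "s \<le> T" "\<And>t. 0 \<le> t \<Longrightarrow> t \<le> T \<Longrightarrow> norm (w t) \<le> norm (w s)"
    using continuous_attains_sup[of "{0..T}" "\<lambda>t. norm (w t)"] \<open>T \<ge> 0\<close> by auto
  have "((\<lambda>t. w t \<bullet> w t) has_derivative (\<lambda>x. x * (2 * (w t \<bullet> w' t)))) (at t within {0..s})"
    if "0 \<le> t" "t \<le> s" for t
  proof -
    have "(w has_vector_derivative w' t) (at t within {0..s})"
      using that by (intro has_vector_derivative_within_subset[OF der]) auto
    from bounded_bilinear.has_vector_derivative[OF bounded_bilinear_inner this this]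
    show ?thesis by (simp add: has_vector_derivative_def inner_commute)
  qed
  from mvt_very_simple[OF s(1) this] obtain z where z: "0 \<le> z" "z \<le> s"
    "w s \<bullet> w s - w 0 \<bullet> w 0 = (s - 0) * (2 * (w z \<bullet> w' z))"
    by auto
  have "norm (w s) * norm (w s) = 2 * s * (w z \<bullet> w' z)"
    using z(3) \<open>w 0 = 0\<close> by (simp add: dot_square_norm power2_eq_square)
  also have "\<dots> \<le> 2 * s * (k * norm (w s))"
  proof -
    have "w z \<bullet> w' z \<le> k * norm (w z)" using k z s by auto
    also have "\<dots> \<le> k * norm (w s)" using s(2,3) z \<open>k \<ge> 0\<close> by (intro mult_left_mono) auto
    finally show ?thesis using s(1) by (intro mult_left_mono) auto
  qed
  also have "\<dots> \<le> 2 * T * (k * norm (w s))"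
    using s(2) \<open>k \<ge> 0\<close> by (intro mult_right_mono) auto
  finally have "norm (w s) * norm (w s) \<le> (2 * T * k) * norm (w s)"
    by (simp add: mult.assoc)
  then have "norm (w s) \<le> 2 * T * k"
    using \<open>T \<ge> 0\<close> \<open>k \<ge> 0\<close> by (cases "norm (w s) = 0") (auto dest: mult_right_le_imp_le)
  moreover have "norm (w T) \<le> norm (w s)" using s(3)[of T] \<open>T \<ge> 0\<close> by simp
  ultimately show ?thesis by linarith
qed


section \<open>Growth of solutions\<close>

context evolution_framework
begin

text \<open>Uniqueness of the lifting forces linearity, since sums and multiples of liftings solve
  the problem for the combined data; the a priori bound gives continuity. Bounded linearity is what
  lets the lifting commute with differentiation in time.\<close>

lemma bounded_linear_lift:
  obtains L where "bounded_linear L"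
    "\<And>\<Xi>. J (L \<Xi>) = A_star (L \<Xi>) + G (fst \<Xi>)" "\<And>\<Xi>. B (L \<Xi>) = snd \<Xi>"
proof -
  interpret J: bounded_linear J by (rule embedding)
  interpret A: bounded_linear A_star by (rule bounded_linear_A_star)
  interpret B: bounded_linear B by (rule bounded_linear_B)
  interpret G: bounded_linear G by (rule bounded_linear_G)
  define L where "L \<Xi> = (THE U. J U = A_star U + G (fst \<Xi>) \<and> B U = snd \<Xi>)" for \<Xi>
  have L: "J (L \<Xi>) = A_star (L \<Xi>) + G (fst \<Xi>) \<and> B (L \<Xi>) = snd \<Xi>" for \<Xi>
    unfolding L_def by (rule theI') (rule lifting_ex1)
  have unique: "L \<Xi> = U" if "J U = A_star U + G (fst \<Xi>)" "B U = snd \<Xi>" for \<Xi> U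
    using lifting_ex1[of "fst \<Xi>" "snd \<Xi>"] L[of \<Xi>] that by blast
  obtain C where C: "\<And>\<xi> chi U. J U = A_star U + G \<xi> \<Longrightarrow> B U = chi \<Longrightarrow>
      norm (J U) + norm U \<le> C * norm (\<xi>, chi)"
    using lifting_bound by blast
  have "bounded_linear L"
  proof (rule bounded_linear_intro)
    show "L (x + y) = L x + L y" for x y
      using L[of x] L[of y] by (intro unique) (simp_all add: J.add A.add G.add B.add)
    show "L (c *\<^sub>R x) = c *\<^sub>R L x" for c x
      using L[of x] by (intro unique) (simp_all add: J.scaleR A.scaleR G.scaleR B.scaleR scaleR_add_right)
    show "norm (L x) \<le> norm x * C" for x
    proof -
      have "norm (J (L x)) + norm (L x) \<le> C * norm (fst x, snd x)"
        using L[of x] by (intro C) simp_all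
      then show ?thesis
        using norm_ge_zero[of "J (L x)"] by (simp only: prod.collapse mult.commute)
    qed
  qed
  with L show ?thesis using that by blast
qed

text \<open>With V = U - L \<Xi>, the curve w = \<open>J V\<close> has derivative
  \<open>A_star V\<close> + f, where f = P \<Xi> + F - P \<Xi>' and P = \<open>J\<close> composed
  with L. As V lies in Ker B, only f contributes to the energy. Since \<Xi>' is bounded, \<Xi> and
  hence f grow at most linearly, and integration in time gives the quadratic bound.\<close>

lemma solution_growth:
  assumes der: "\<And>t. t \<ge> 0 \<Longrightarrow> ((\<lambda>s. J (U s)) has_vector_derivative
        A_star (U t) + G (\<xi> t) + F t) (at t within {0..})"
    and U: "U 0 = 0" "\<And>t. t \<ge> 0 \<Longrightarrow> B (U t) = chi t"
    and \<Xi>: "\<And>t. t \<ge> 0 \<Longrightarrow> ((\<lambda>t. (\<xi> t, chi t)) has_vector_derivative \<Xi>' t) (at t within {0..})"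
      "(\<xi> 0, chi 0) = 0"
    and F: "\<And>t. t \<ge> 0 \<Longrightarrow> norm (F t) \<le> M1" and \<Xi>': "\<And>t. t \<ge> 0 \<Longrightarrow> norm (\<Xi>' t) \<le> M2"
  obtains K where "K \<ge> 0" "\<And>t. t \<ge> 0 \<Longrightarrow> norm (J (U t)) \<le> K * (1 + t) ^ 2"
    "\<And>t. t \<ge> 0 \<Longrightarrow> norm (G (\<xi> t) + F t) \<le> K * (1 + t)"
proof -
  interpret J: bounded_linear J by (rule embedding)
  interpret A: bounded_linear A_star by (rule bounded_linear_A_star)
  interpret B: bounded_linear B by (rule bounded_linear_B)
  interpret G: bounded_linear G by (rule bounded_linear_G)
  obtain L where "bounded_linear L" and
    L: "\<And>\<Xi>. J (L \<Xi>) = A_star (L \<Xi>) + G (fst \<Xi>)" "\<And>\<Xi>. B (L \<Xi>) = snd \<Xi>"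
    using bounded_linear_lift by blast
  define P where "P \<Xi> = J (L \<Xi>)" for \<Xi>
  interpret P: bounded_linear P
    unfolding P_def using bounded_linear_compose[OF embedding(1) \<open>bounded_linear L\<close>] by simp
  obtain p where p: "p \<ge> 0" "\<And>x. norm (P x) \<le> norm x * p"
    using P.nonneg_bounded by blast
  obtain q where q: "q \<ge> 0" "\<And>x. norm (G x) \<le> norm x * q"
    using G.nonneg_bounded by blast
  have M: "M1 \<ge> 0" "M2 \<ge> 0"
    using F[of 0] \<Xi>'[of 0] norm_ge_zero order_trans by (meson order_refl)+
  define \<Xi> where "\<Xi> t = (\<xi> t, chi t)" for t
  have \<Xi>_der: "(\<Xi> has_vector_derivative \<Xi>' t) (at t within {0..})" if "t \<ge> 0" for t
    using \<Xi>(1)[OF that] by (simp add: \<Xi>_def[abs_def])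
  have \<Xi>_bound: "norm (\<Xi> t) \<le> M2 * t" if "t \<ge> 0" for t
    using derivative_bound_linear_growth[OF \<Xi>_der _ \<Xi>' that] \<Xi>(2) by (simp add: \<Xi>_def)
  define w where "w t = J (U t) - P (\<Xi> t)" for t
  define w' where "w' t = A_star (U t) + G (\<xi> t) + F t - P (\<Xi>' t)" for t
  \<comment> \<open>The summands bound P \<Xi>, F and P \<Xi>' in turn. As \<open>k\<close> is
    nondecreasing, \<open>k T\<close> serves as the constant on all of [0, T].\<close>
  define k where "k t = p * (M2 * t) + M1 + p * M2" for t
  have w_growth: "norm (w T) \<le> 2 * T * k T" if "T \<ge> 0" for T
  proof (rule energy_estimate)
    show "(w has_vector_derivative w' t) (at t within {0..})" if "t \<ge> 0" for t
      unfolding w_def w'_def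
      by (intro has_vector_derivative_diff der that P.has_vector_derivative \<Xi>_der)
    show "w 0 = 0" using U(1) \<Xi>(2) by (simp add: w_def \<Xi>_def J.zero P.zero)
    show "k T \<ge> 0" using p M \<open>T \<ge> 0\<close> by (simp add: k_def)
    fix t assume t: "0 \<le> t" "t \<le> T"
    define f where "f = P (\<Xi> t) + F t - P (\<Xi>' t)"
    have "A_star (U t - L (\<Xi> t)) \<bullet> J (U t - L (\<Xi> t)) = 0"
      using U(2)[OF t(1)] by (intro skew) (simp add: B.diff L \<Xi>_def)
    moreover have "w t = J (U t - L (\<Xi> t))"
      by (simp add: w_def P_def J.diff)
    moreover have "w' t = A_star (U t - L (\<Xi> t)) + f"
      using L(1)[of "\<Xi> t"] by (simp add: w'_def f_def P_def A.diff \<Xi>_def)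
    ultimately have "w t \<bullet> w' t = w t \<bullet> f"
      by (simp add: inner_add_right inner_commute)
    have "norm f \<le> norm (P (\<Xi> t)) + norm (F t) + norm (P (\<Xi>' t))"
      unfolding f_def by (intro norm_triangle_le_diff norm_triangle_le add_right_mono) simp
    also have "\<dots> \<le> k T"
      unfolding k_def
    proof (intro add_mono)
      have "norm (P (\<Xi> t)) \<le> norm (\<Xi> t) * p" by (rule p)
      also have "\<dots> \<le> (M2 * T) * p"
        using \<Xi>_bound[OF t(1)] t M p by (intro mult_right_mono order_trans[OF \<Xi>_bound] mult_left_mono)
      finally show "norm (P (\<Xi> t)) \<le> p * (M2 * T)" by (simp add: mult.commute)
      have "norm (P (\<Xi>' t)) \<le> norm (\<Xi>' t) * p" by (rule p)
      also have "\<dots> \<le> M2 * p" using \<Xi>'[OF t(1)] p by (intro mult_right_mono)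
      finally show "norm (P (\<Xi>' t)) \<le> p * M2" by (simp add: mult.commute)
    qed (rule F[OF t(1)])
    finally have "norm f \<le> k T" .
    then have "norm (w t) * norm f \<le> norm (w t) * k T"
      by (intro mult_left_mono) simp_all
    with \<open>w t \<bullet> w' t = w t \<bullet> f\<close> show "w t \<bullet> w' t \<le> k T * norm (w t)"
      using norm_cauchy_schwarz[of "w t" f] by (simp add: mult.commute)
  qed fact
  \<comment> \<open>The first two summands come from w and from P \<Xi>, the last two from
    \<open>G \<xi>\<close> and F; adding them lets one constant serve both bounds.\<close>
  define K where "K = 2 * (p * M2 + M1) + p * M2 + q * M2 + M1"
  show ?thesis
  proof (rule that[of K])
    show "K \<ge> 0" using p q M by (simp add: K_def)
    fix t :: real assume t: "t \<ge> 0"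
    have "norm (J (U t)) \<le> norm (w t) + norm (P (\<Xi> t))"
      using norm_triangle_ineq[of "w t" "P (\<Xi> t)"] by (simp add: w_def)
    also have "\<dots> \<le> 2 * t * k t + p * M2 * t"
    proof (intro add_mono w_growth t)
      have "norm (P (\<Xi> t)) \<le> norm (\<Xi> t) * p" by (rule p)
      also have "\<dots> \<le> (M2 * t) * p" using \<Xi>_bound[OF t] p by (intro mult_right_mono)
      finally show "norm (P (\<Xi> t)) \<le> p * M2 * t" by (simp add: mult_ac)
    qed
    also have "\<dots> \<le> 2 * (p * M2 + M1) * (1 + t) ^ 2 + p * M2 * (1 + t) ^ 2"
    proof (intro add_mono)
      have "k t \<le> (p * M2 + M1) * (1 + t)"
        using t M p by (simp add: k_def algebra_simps)
      then have "2 * t * k t \<le> 2 * t * ((p * M2 + M1) * (1 + t))"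
        using t by (intro mult_left_mono) auto
      also have "\<dots> \<le> 2 * (1 + t) * ((p * M2 + M1) * (1 + t))"
        using t M p by (intro mult_right_mono) auto
      finally show "2 * t * k t \<le> 2 * (p * M2 + M1) * (1 + t) ^ 2"
        by (simp add: power2_eq_square algebra_simps)
      have "t \<le> (1 + t) ^ 2" using t by (simp add: power2_eq_square algebra_simps)
      then show "p * M2 * t \<le> p * M2 * (1 + t) ^ 2" using p M by (intro mult_left_mono) auto
    qed
    also have "\<dots> \<le> K * (1 + t) ^ 2"
      unfolding K_def distrib_right[symmetric] using p q M by (intro mult_right_mono) auto
    finally show "norm (J (U t)) \<le> K * (1 + t) ^ 2" .
    have "norm (\<xi> t) \<le> M2 * t"
      using \<Xi>_bound[OF t] norm_fst_le[of "\<xi> t" "chi t"] by (simp add: \<Xi>_def)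
    then have "norm (G (\<xi> t)) \<le> M2 * t * q"
      using q(1) by (intro order_trans[OF q(2)] mult_right_mono)
    then have "norm (G (\<xi> t) + F t) \<le> M2 * t * q + M1"
      using F[OF t] by (intro norm_triangle_le) simp
    also have "\<dots> \<le> (q * M2 + M1) * (1 + t)"
      using t M q by (simp add: algebra_simps)
    also have "\<dots> \<le> K * (1 + t)"
      unfolding K_def using t p q M by (intro mult_right_mono) auto
    finally show "norm (G (\<xi> t) + F t) \<le> K * (1 + t)" .
  qed
qed

text \<open>Since \<open>U\<close> is continuous into \<open>V\<close>, bounded operators pass under
  its integral, and the equation integrated over [0, t] expresses \<open>A_star\<close> of the
  primitive as J U(t) minus the integral of h. The lower graph norm estimate then turns bounds in
  \<open>H\<close> into a bound in \<open>V\<close>.\<close>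

lemma primitive_growth:
  assumes der: "\<And>t. t \<ge> 0 \<Longrightarrow> ((\<lambda>s. J (U s)) has_vector_derivative
        A_star (U t) + h t) (at t within {0..})"
    and U: "U 0 = 0" "continuous_on {0..} U" and h: "continuous_on {0..} h"
    and K: "K \<ge> 0" "\<And>t. t \<ge> 0 \<Longrightarrow> norm (J (U t)) \<le> K * (1 + t) ^ 2"
      "\<And>t. t \<ge> 0 \<Longrightarrow> norm (h t) \<le> K * (1 + t)"
  obtains C where "\<And>t. t \<ge> 0 \<Longrightarrow> norm (integral {0..t} U) \<le> C * (1 + t) ^ 3"
proof -
  interpret J: bounded_linear J by (rule embedding)
  interpret A: bounded_linear A_star by (rule bounded_linear_A_star)
  obtain C1 where C1: "C1 > 0" "\<And>U. C1 * norm U \<le> norm (J U) + norm (A_star U)"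
    using graph_norm by blast
  show ?thesis
  proof (rule that[of "3 * K / C1"])
    fix t :: real assume t: "t \<ge> 0"
    have U_int: "(U has_integral integral {0..t} U) {0..t}"
      using U(2) by (intro integrable_integral integrable_continuous_real)
        (auto intro: continuous_on_subset)
    have h_int: "(h has_integral integral {0..t} h) {0..t}"
      using h by (intro integrable_integral integrable_continuous_real)
        (auto intro: continuous_on_subset)
    have mono: "K * (1 + s) ^ n \<le> K * (1 + t) ^ n" if "0 \<le> s" "s \<le> t" for s n
      using that K(1) by (intro mult_left_mono power_mono) auto
    have "((\<lambda>s. J (U s)) has_integral J (integral {0..t} U)) {0..t}"
      using has_integral_linear[OF U_int embedding(1)] by (simp add: o_def)
    from has_integral_bound_real[OF _ finite.emptyI this, of "K * (1 + t) ^ 2"]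
    have J_bound: "norm (J (integral {0..t} U)) \<le> K * (1 + t) ^ 2 * t"
      using K(1) order_trans[OF K(2) mono[of _ 2]] t by simp
    from has_integral_bound_real[OF _ finite.emptyI h_int, of "K * (1 + t)"]
    have h_bound: "norm (integral {0..t} h) \<le> K * (1 + t) * t"
      using K(1) order_trans[OF K(3) mono[of _ 1, simplified]] t by simp
    have "((\<lambda>s. A_star (U s) + h s) has_integral A_star (integral {0..t} U) + integral {0..t} h) {0..t}"
      using has_integral_add[OF has_integral_linear[OF U_int bounded_linear_A_star] h_int]
      by (simp add: o_def)
    moreover have "((\<lambda>s. A_star (U s) + h s) has_integral J (U t) - J (U 0)) {0..t}"
      using t
      by (intro fundamental_theorem_of_calculus has_vector_derivative_within_subset[OF der]) auto
    ultimately have "A_star (integral {0..t} U) = J (U t) - integral {0..t} h"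
      using U(1) by (metis J.zero add_diff_cancel_right' diff_zero has_integral_unique)
    then have A_bound: "norm (A_star (integral {0..t} U)) \<le> K * (1 + t) ^ 2 + K * (1 + t) * t"
      using K(2)[OF t] h_bound by (simp add: norm_triangle_le_diff)
    have "C1 * norm (integral {0..t} U) \<le> K * ((1 + t) ^ 2 * t + (1 + t) ^ 2 + (1 + t) * t)"
      using C1(2)[of "integral {0..t} U"] J_bound A_bound by (simp add: algebra_simps)
    \<comment> \<open>Each of the three terms in the bracket is at most the cube of 1 + t.\<close>
    also have "\<dots> \<le> K * (3 * (1 + t) ^ 3)"
      using K(1) t by (intro mult_left_mono) (simp_all add: power2_eq_square power3_eq_cube algebra_simps)
    finally show "norm (integral {0..t} U) \<le> 3 * K / C1 * (1 + t) ^ 3"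
      using C1(1) by (simp add: field_simps)
  qed
qed

end

section \<open>Membership of the extended solution in TD\<close>

lemma reg_dist_ext0_in_TD:
  fixes f :: "real \<Rightarrow> 'a::banach"
  assumes f: "continuous_on {0..} f" "f 0 = 0"
    and C: "\<And>t. t \<ge> 0 \<Longrightarrow> norm (integral {0..t} f) \<le> C * (1 + t) ^ 3"
  shows "reg_dist (ext0 f) \<in> TD"
proof -
  define g where "g t = integral {0..t} f" for t
  have g: "(g has_vector_derivative f t) (at t within {0..})" if "t \<ge> 0" for t
  proof -
    \<comment> \<open>The interval reaches beyond t so that it is a neighbourhood of t relative to
      the half line.\<close>
    have "(g has_vector_derivative f t) (at t within {0..t + 1})"
      unfolding g_def
      using that by (intro integral_has_vector_derivative continuous_on_subset[OF f(1)]) auto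
    moreover have "at t within {0..t + 1} = at t within {0..}"
      by (rule at_within_nhd[of _ "{..<t + 1}"]) auto
    ultimately show ?thesis by simp
  qed
  have "g 0 = 0" by (simp add: g_def)
  have "dist_deriv (reg_dist (ext0 g)) = reg_dist (ext0 f)"
    by (rule dist_deriv_reg_dist_ext0[OF g f(1) \<open>g 0 = 0\<close> f(2)])
  then have "reg_dist (ext0 f) = (dist_deriv ^^ 1) (reg_dist (ext0 g))" by simp
  moreover have "continuous_on {0..} g"
    using g by (intro continuous_on_vector_derivative) auto
  then have "continuous_on UNIV (ext0 g)" by (intro continuous_on_ext0 \<open>g 0 = 0\<close>)
  moreover have "\<forall>t\<le>0. ext0 g t = 0" using \<open>g 0 = 0\<close> by (auto simp: ext0_def)
  \<comment> \<open>For t \<ge> 1 one has 1 + t \<le> 2t, and cubing gives the factor 8.\<close>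
  moreover have "norm (ext0 g t) \<le> (8 * C) * t powr 3" if "t \<ge> 1" for t
  proof -
    have "C \<ge> 0" using C[of 0] by simp
    have "norm (ext0 g t) \<le> C * (1 + t) ^ 3" using C[of t] that by (simp add: ext0_def g_def)
    also have "\<dots> \<le> C * (2 * t) ^ 3" using that \<open>C \<ge> 0\<close> by (intro mult_left_mono power_mono) auto
    finally show ?thesis using that by (simp add: power_mult_distrib powr_numeral)
  qed
  ultimately show ?thesis
    using is_distribution_reg_dist[OF continuous_on_ext0[OF f]]
    unfolding TD_def by (blast intro: exI[of _ 3] zero_le_numeral)
qed

lemma bounded_linear_ext0:
  assumes "bounded_linear L"
  shows "L (ext0 f t) = ext0 (\<lambda>t. L (f t)) t"
  using linear_0[OF bounded_linear.linear[OF assms]] by (simp add: ext0_def)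


section \<open>The distributional problem\<close>

theorem theorem3p2:
  fixes J :: "'v::{real_inner,banach} \<Rightarrow> 'h::{real_inner,banach}"
    and A_star :: "'v \<Rightarrow> 'h"
    and G :: "'m1::{real_inner,banach} \<Rightarrow> 'h"
    and B :: "'v \<Rightarrow> 'm2::{real_inner,banach}"
    and F :: "real \<Rightarrow> 'h" and \<xi> :: "real \<Rightarrow> 'm1" and chi :: "real \<Rightarrow> 'm2"
    and U :: "real \<Rightarrow> 'v"
  assumes framework: "evolution_framework J A_star G B"
    and F: "W_half 1 F"
    and \<Xi>: "W_half 2 (\<lambda>t. (\<xi> t, chi t))"
    and U_C1: "C_half 1 (\<lambda>t. J (U t))"
    and U_C0: "C_half 0 U"
    and U_eq: "\<And>t. t \<ge> 0 \<Longrightarrow>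
          half_deriv (\<lambda>s. J (U s)) t = A_star (U t) + G (\<xi> t) + F t"
    and U_bc: "\<And>t. t \<ge> 0 \<Longrightarrow> B (U t) = chi t"
    and U_init: "U 0 = 0"
  shows "dist_solution J A_star G B
           (reg_dist (ext0 \<xi>)) (reg_dist (ext0 chi)) (reg_dist (ext0 F)) (reg_dist (ext0 U)) \<and>
         (\<forall>T. dist_solution J A_star G B
           (reg_dist (ext0 \<xi>)) (reg_dist (ext0 chi)) (reg_dist (ext0 F)) T
           \<longrightarrow> T = reg_dist (ext0 U))"
proof -
  interpret evolution_framework J A_star G B by (rule framework)
  note bl = embedding(1) bounded_linear_A_star bounded_linear_G bounded_linear_B
  note F1 = W_half_1D[OF F]
  note \<Xi>2 = W_half_2D[OF \<Xi>]
  note \<Xi>_der = C_half_1_has_vector_derivative[OF \<Xi>2(1)]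
  have U: "continuous_on {0..} U" using U_C0 by (simp add: C_half_def)
  have "continuous_on {0..} (\<lambda>t. (\<xi> t, chi t))"
    using \<Xi>_der by (intro continuous_on_vector_derivative) auto
  then have \<xi>: "continuous_on {0..} \<xi>"
    using continuous_on_fst by fastforce
  have \<xi>0: "\<xi> 0 = 0" using \<Xi>2(2) by (simp add: zero_prod_def)
  have der: "((\<lambda>s. J (U s)) has_vector_derivative A_star (U t) + G (\<xi> t) + F t) (at t within {0..})"
    if "t \<ge> 0" for t
    using C_half_1_has_vector_derivative[OF U_C1 that] U_eq[OF that] by simp
  note cont = continuous_on_ext0[OF U U_init] continuous_on_ext0[OF \<xi> \<xi>0]
    continuous_on_ext0[OF F1(1,2)]
  obtain M1 M2 where M: "\<And>t. t \<ge> 0 \<Longrightarrow> norm (F t) \<le> M1"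
    "\<And>t. t \<ge> 0 \<Longrightarrow> norm (half_deriv (\<lambda>t. (\<xi> t, chi t)) t) \<le> M2"
    using F1(3) W_half_1D(3)[OF \<Xi>2(3)] by blast
  obtain K where K: "K \<ge> 0" "\<And>t. t \<ge> 0 \<Longrightarrow> norm (J (U t)) \<le> K * (1 + t) ^ 2"
    "\<And>t. t \<ge> 0 \<Longrightarrow> norm (G (\<xi> t) + F t) \<le> K * (1 + t)"
    using solution_growth[OF der U_init U_bc \<Xi>_der \<Xi>2(2) M] by blast
  have "continuous_on {0..} (\<lambda>t. G (\<xi> t) + F t)"
    by (intro continuous_intros F1 bounded_linear.continuous_on[OF bl(3)] \<xi>)
  then obtain C where "\<And>t. t \<ge> 0 \<Longrightarrow> norm (integral {0..t} U) \<le> C * (1 + t) ^ 3"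
    using primitive_growth[of U "\<lambda>t. G (\<xi> t) + F t" K] der U_init U K
    by (auto simp: add.assoc)
  then have TD: "reg_dist (ext0 U) \<in> TD"
    by (rule reg_dist_ext0_in_TD[OF U U_init])
  have "dist_deriv (J \<circ> reg_dist (ext0 U)) = dist_deriv (reg_dist (ext0 (\<lambda>t. J (U t))))"
    by (simp add: o_def bounded_linear_reg_dist[OF bl(1) cont(1)] bounded_linear_ext0[OF bl(1)])
  \<comment> \<open>\<open>U\<close>, \<xi> and \<open>F\<close> all vanish at 0, so the right-hand
    side does too and the extension of \<open>J U\<close> is continuously differentiable across
    0.\<close>
  also have "\<dots> = reg_dist (ext0 (\<lambda>t. A_star (U t) + G (\<xi> t) + F t))"
  proof (rule dist_deriv_reg_dist_ext0[OF der])
    show "continuous_on {0..} (\<lambda>t. A_star (U t) + G (\<xi> t) + F t)"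
      by (intro continuous_intros F1 bounded_linear.continuous_on[OF bl(2)]
          bounded_linear.continuous_on[OF bl(3)] \<xi> U)
  qed (use U_init \<xi>0 F1(2) bl in \<open>simp_all add: linear_0 bounded_linear.linear\<close>)
  also have "ext0 (\<lambda>t. A_star (U t) + G (\<xi> t) + F t) =
      (\<lambda>t. A_star (ext0 U t) + G (ext0 \<xi> t) + ext0 F t)"
    by (auto simp: fun_eq_iff ext0_def linear_0 bl bounded_linear.linear)
  also have "reg_dist \<dots> =
      (\<lambda>\<phi>. A_star (reg_dist (ext0 U) \<phi>) + G (reg_dist (ext0 \<xi>) \<phi>) + reg_dist (ext0 F) \<phi>)"
    by (intro ext)
      (simp add: reg_dist_add continuous_on_add bounded_linear_reg_dist bl cont bounded_linear.continuous_on)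
  finally have eq: "dist_deriv (J \<circ> reg_dist (ext0 U)) =
      (\<lambda>\<phi>. A_star (reg_dist (ext0 U) \<phi>) + G (reg_dist (ext0 \<xi>) \<phi>) + reg_dist (ext0 F) \<phi>)" .
  \<comment> \<open>For negative times both sides are zero by linearity of \<open>B\<close>; for the
    others this is the boundary condition. It represents the extended \<open>chi\<close> as
    \<open>B\<close> applied to a continuous function.\<close>
  have "(\<lambda>t. B (ext0 U t)) = ext0 chi"
    using U_bc linear_0[OF bounded_linear.linear[OF bl(4)]] by (auto simp: ext0_def)
  then have "B \<circ> reg_dist (ext0 U) = reg_dist (ext0 chi)"
    by (simp add: o_def bounded_linear_reg_dist[OF bl(4) cont(1)])
  with TD eq have "dist_solution J A_star G B
      (reg_dist (ext0 \<xi>)) (reg_dist (ext0 chi)) (reg_dist (ext0 F)) (reg_dist (ext0 U))"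
    by (simp add: dist_solution_def)
  then show ?thesis using dist_solution_unique by blast
qed

end
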